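(* Let $k$ be an algebraically closed field, let $n\ge 2$, let $Q_1,\dots,Q_n$ be finite, connected, acyclic quivers, and let $\mathscr{Q}_{(Q_1,\dots,Q_n)}$ be the $n$-quiver induced by $(Q_1,\dots,Q_n)$. There exists an equivalence of categories $Rep_{(Q_1,\dots,Q_n)}\simeq Rep_k(\mathscr{Q}_{(Q_1,\dots,Q_n)})$ that restricts to an equivalence $rep_{(Q_1,\dots,Q_n)}\simeq rep_k(\mathscr{Q}_{(Q_1,\dots,Q_n)})$.
   Context: A quiver has a vertex set, an arrow set, and source and target maps $s,t$ from arrows to vertices. $Rep_k(Q)$ is the category of $k$-linear representations $M=(M_i,\varphi_\alpha)$ of $Q$ ($k$-vector spaces $M_i$ for vertices $i$, $k$-linear maps $\varphi_\alpha:M_{s(\alpha)}\to M_{t(\alpha)}$ for arrows $\alpha$); morphisms are families of linear maps $f_i$ commuting with the structure maps. $rep_k(Q)$ is the full subcategory of finite-dimensional representations. An $n$-representation of $(Q_1,\dots,Q_n)$ is a $(2n-1)$-tuple $(V^{(1)},\dots,V^{(n)},\psi_1,\dots,\psi_{n-1})$ where $V^{(m)}\in Rep_k(Q_m)$ and, for $1\le m\le n-1$, $\psi_m$ is a family of $k$-linear maps $(\psi_m)_{\gamma}^{\delta}:V^{(m)}_{t(\gamma)}\to V^{(m+1)}_{s(\delta)}$, one for each pair ($\gamma$ an arrow of $Q_m$, $\delta$ an arrow of $Q_{m+1}$). A morphism to $(W^{(1)},\dots,W^{(n)},\theta_1,\dots,\theta_{n-1})$ is an $n$-tuple $(f^{(1)},\dots,f^{(n)})$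 of morphisms $f^{(m)}:V^{(m)}\to W^{(m)}$ in $Rep_k(Q_m)$ with $f^{(m+1)}_{s(\delta)}(\psi_m)_\gamma^\delta=(\theta_m)_\gamma^\delta f^{(m)}_{t(\gamma)}$ for all such $m,\gamma,\delta$. These form the category $Rep_{(Q_1,\dots,Q_n)}$; $rep_{(Q_1,\dots,Q_n)}$ is its full subcategory of finite-dimensional $n$-representations (all vector spaces finite dimensional). The $n$-quiver $\mathscr{Q}_{(Q_1,\dots,Q_n)}$ is the quiver whose vertex set is the disjoint union of the vertex sets of $Q_1,\dots,Q_n$, and whose arrows are the disjoint union of the arrows of $Q_1,\dots,Q_n$ (with their original sources and targets) together with, for each $1\le m\le n-1$ and each pair ($\gamma$ an arrow of $Q_m$, $\delta$ an arrow of $Q_{m+1}$), one new arrow from $t(\gamma)$ to $s(\delta)$. *)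

theory Defs
  imports
    "HOL-Library.FuncSet"
    "HOL-Algebra.Algebraic_Closure"
    "Graph_Theory.Graph_Theory"
    "Jordan_Normal_Form.Missing_VectorSpace"
begin

section \<open>Categories, functors and equivalences\<close>

text \<open>
  A category is given by a set of objects and indexed hom-sets, which need not be disjoint;
  \<open>Cmp C x y z g f\<close> is the composite of \<open>f : x \<rightarrow> y\<close> and \<open>g : y \<rightarrow> z\<close>.
  The values of all fields outside their intended domain are irrelevant, and likewise for functors,
  so that a functor and its restriction to a full subcategory are given by the same data.
\<close>

record ('o, 'm) cat =
  Ob :: "'o set"
  Mor :: "'o \<Rightarrow> 'o \<Rightarrow> 'm set"
  Idm :: "'o \<Rightarrow> 'm"
  Cmp :: "'o \<Rightarrow> 'o \<Rightarrow> 'o \<Rightarrow> 'm \<Rightarrow> 'm \<Rightarrow> 'm"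

locale category =
  fixes C :: "('o, 'm) cat"
  assumes Idm_in: "x \<in> Ob C \<Longrightarrow> Idm C x \<in> Mor C x x"
    and Cmp_in: "\<lbrakk>x \<in> Ob C; y \<in> Ob C; z \<in> Ob C; f \<in> Mor C x y; g \<in> Mor C y z\<rbrakk>
      \<Longrightarrow> Cmp C x y z g f \<in> Mor C x z"
    and Cmp_Idm_left: "\<lbrakk>x \<in> Ob C; y \<in> Ob C; f \<in> Mor C x y\<rbrakk>
      \<Longrightarrow> Cmp C x y y (Idm C y) f = f"
    and Cmp_Idm_right: "\<lbrakk>x \<in> Ob C; y \<in> Ob C; f \<in> Mor C x y\<rbrakk>
      \<Longrightarrow> Cmp C x x y f (Idm C x) = f"
    and Cmp_assoc: "\<lbrakk>w \<in> Ob C; x \<in> Ob C; y \<in> Ob C; z \<in> Ob C;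
        f \<in> Mor C w x; g \<in> Mor C x y; h \<in> Mor C y z\<rbrakk>
      \<Longrightarrow> Cmp C w y z h (Cmp C w x y g f) = Cmp C w x z (Cmp C x y z h g) f"

definition full_subcat :: "('o, 'm) cat \<Rightarrow> ('o \<Rightarrow> bool) \<Rightarrow> ('o, 'm) cat" where
  "full_subcat C P = C\<lparr>Ob := {x \<in> Ob C. P x}\<rparr>"

definition is_iso :: "('o, 'm) cat \<Rightarrow> 'o \<Rightarrow> 'o \<Rightarrow> 'm \<Rightarrow> bool" where
  "is_iso C x y f \<longleftrightarrow> f \<in> Mor C x y \<and>
    (\<exists>g \<in> Mor C y x. Cmp C x y x g f = Idm C x \<and> Cmp C y x y f g = Idm C y)"

record ('o, 'm, 'p, 'q) fctr =
  on_ob :: "'o \<Rightarrow> 'p"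
  on_mor :: "'o \<Rightarrow> 'o \<Rightarrow> 'm \<Rightarrow> 'q"

locale cat_functor = C: category C + D: category D
  for C :: "('o, 'm) cat" and D :: "('p, 'q) cat" +
  fixes F :: "('o, 'm, 'p, 'q) fctr"
  assumes on_ob_in: "x \<in> Ob C \<Longrightarrow> on_ob F x \<in> Ob D"
    and on_mor_in: "\<lbrakk>x \<in> Ob C; y \<in> Ob C; f \<in> Mor C x y\<rbrakk>
      \<Longrightarrow> on_mor F x y f \<in> Mor D (on_ob F x) (on_ob F y)"
    and on_mor_Idm: "x \<in> Ob C \<Longrightarrow> on_mor F x x (Idm C x) = Idm D (on_ob F x)"
    and on_mor_Cmp: "\<lbrakk>x \<in> Ob C; y \<in> Ob C; z \<in> Ob C; f \<in> Mor C x y; g \<in> Mor C y z\<rbrakk>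
      \<Longrightarrow> on_mor F x z (Cmp C x y z g f) =
          Cmp D (on_ob F x) (on_ob F y) (on_ob F z) (on_mor F y z g) (on_mor F x y f)"

definition id_fctr :: "('o, 'm, 'o, 'm) fctr" where
  "id_fctr = \<lparr>on_ob = \<lambda>x. x, on_mor = \<lambda>x y f. f\<rparr>"

definition comp_fctr ::
    "('p, 'q, 'r, 's) fctr \<Rightarrow> ('o, 'm, 'p, 'q) fctr \<Rightarrow> ('o, 'm, 'r, 's) fctr" where
  "comp_fctr G F =
    \<lparr>on_ob = \<lambda>x. on_ob G (on_ob F x),
     on_mor = \<lambda>x y f. on_mor G (on_ob F x) (on_ob F y) (on_mor F x y f)\<rparr>"

locale natural_iso = F: cat_functor C D F + G: cat_functor C D G
  for C :: "('o, 'm) cat" and D :: "('p, 'q) cat" and F G +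
  fixes \<tau> :: "'o \<Rightarrow> 'q"
  assumes component_iso: "x \<in> Ob C \<Longrightarrow> is_iso D (on_ob F x) (on_ob G x) (\<tau> x)"
    and naturality: "\<lbrakk>x \<in> Ob C; y \<in> Ob C; f \<in> Mor C x y\<rbrakk>
      \<Longrightarrow> Cmp D (on_ob F x) (on_ob F y) (on_ob G y) (\<tau> y) (on_mor F x y f) =
          Cmp D (on_ob F x) (on_ob G x) (on_ob G y) (on_mor G x y f) (\<tau> x)"

definition cat_equivalence ::
    "('o, 'm) cat \<Rightarrow> ('p, 'q) cat \<Rightarrow> ('o, 'm, 'p, 'q) fctr \<Rightarrow> bool" where
  "cat_equivalence C D F \<longleftrightarrow> cat_functor C D F \<and>
    (\<exists>G. cat_functor D C G \<and>
      (\<exists>\<eta>. natural_iso C C id_fctr (comp_fctr G F) \<eta>) \<and>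
      (\<exists>\<epsilon>. natural_iso D D (comp_fctr F G) id_fctr \<epsilon>))"


section \<open>Representations of quivers\<close>

text \<open>
  Quivers are directed multigraphs (\<^typ>\<open>('a, 'e) pre_digraph\<close>), with \<^const>\<open>tail\<close> and \<^const>\<open>head\<close>
  as source and target. Vector spaces are carrier-based (\<^const>\<open>vectorspace\<close>) with carrier in an
  arbitrary type \<open>'v\<close>, which plays the role of the universe of sets. All linear maps are
  extensional, i.e. \<open>undefined\<close> outside their domain, so that equality of maps in HOL is
  equality on the domain.
\<close>

definition linear_maps ::
    "('k, 'z) ring_scheme \<Rightarrow> ('k, 'v) module \<Rightarrow> ('k, 'v) module \<Rightarrow> ('v \<Rightarrow> 'v) set" where
  "linear_maps K V W = module_hom K V W \<inter> extensional (carrier V)"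

record ('a, 'e, 'k, 'v) qrep =
  sp :: "'a \<Rightarrow> ('k, 'v) module"
  str :: "'e \<Rightarrow> 'v \<Rightarrow> 'v"

definition reps ::
    "('k, 'z) ring_scheme \<Rightarrow> ('a, 'e) pre_digraph \<Rightarrow> ('a, 'e, 'k, 'v) qrep set" where
  "reps K Q = {M.
    sp M \<in> verts Q \<rightarrow>\<^sub>E {V. vectorspace K V} \<and>
    str M \<in> (\<Pi>\<^sub>E \<alpha>\<in>arcs Q. linear_maps K (sp M (tail Q \<alpha>)) (sp M (head Q \<alpha>)))}"

definition rep_homs ::
    "('k, 'z) ring_scheme \<Rightarrow> ('a, 'e) pre_digraph \<Rightarrow>
     ('a, 'e, 'k, 'v) qrep \<Rightarrow> ('a, 'e, 'k, 'v) qrep \<Rightarrow> ('a \<Rightarrow> 'v \<Rightarrow> 'v) set" where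
  "rep_homs K Q M N = {f \<in> (\<Pi>\<^sub>E i\<in>verts Q. linear_maps K (sp M i) (sp N i)).
    \<forall>\<alpha>\<in>arcs Q. compose (carrier (sp M (tail Q \<alpha>))) (f (head Q \<alpha>)) (str M \<alpha>) =
               compose (carrier (sp M (tail Q \<alpha>))) (str N \<alpha>) (f (tail Q \<alpha>))}"

definition Rep ::
    "('k, 'z) ring_scheme \<Rightarrow> ('a, 'e) pre_digraph \<Rightarrow>
     (('a, 'e, 'k, 'v) qrep, 'a \<Rightarrow> 'v \<Rightarrow> 'v) cat" where
  "Rep K Q =
    \<lparr>Ob = reps K Q,
     Mor = rep_homs K Q,
     Idm = \<lambda>M. \<lambda>i\<in>verts Q. \<lambda>x\<in>carrier (sp M i). x,
     Cmp = \<lambda>L M N g f. \<lambda>i\<in>verts Q. compose (carrier (sp L i)) (g i) (f i)\<rparr>"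

definition fin_dim_rep ::
    "('k, 'z) ring_scheme \<Rightarrow> ('a, 'e) pre_digraph \<Rightarrow> ('a, 'e, 'k, 'v) qrep \<Rightarrow> bool" where
  "fin_dim_rep K Q M \<longleftrightarrow> (\<forall>i\<in>verts Q. vectorspace.fin_dim K (sp M i))"

definition fd_Rep ::
    "('k, 'z) ring_scheme \<Rightarrow> ('a, 'e) pre_digraph \<Rightarrow>
     (('a, 'e, 'k, 'v) qrep, 'a \<Rightarrow> 'v \<Rightarrow> 'v) cat" where
  "fd_Rep K Q = full_subcat (Rep K Q) (fin_dim_rep K Q)"


section \<open>\<open>n\<close>-representations\<close>

text \<open>
  The tuple \<open>(Q\<^sub>1, \<dots>, Q\<^sub>n)\<close> is a function \<open>Q\<close> on \<^typ>\<open>nat\<close>, of which only the values on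
  \<open>{1..n}\<close> are used; \<open>lnk V m \<gamma> \<delta>\<close> is the map \<open>(\<psi>\<^sub>m)\<close> with lower index \<open>\<gamma>\<close> and upper index \<open>\<delta>\<close>.
\<close>

record ('a, 'e, 'k, 'v) nqrep =
  cmpt :: "nat \<Rightarrow> ('a, 'e, 'k, 'v) qrep"
  lnk :: "nat \<Rightarrow> 'e \<Rightarrow> 'e \<Rightarrow> 'v \<Rightarrow> 'v"

definition nreps ::
    "('k, 'z) ring_scheme \<Rightarrow> nat \<Rightarrow> (nat \<Rightarrow> ('a, 'e) pre_digraph) \<Rightarrow>
     ('a, 'e, 'k, 'v) nqrep set" where
  "nreps K n Q = {V.
    cmpt V \<in> (\<Pi>\<^sub>E m\<in>{1..n}. reps K (Q m)) \<and>
    lnk V \<in> (\<Pi>\<^sub>E m\<in>{1..<n}. \<Pi>\<^sub>E \<gamma>\<in>arcs (Q m). \<Pi>\<^sub>E \<delta>\<in>arcs (Q (Suc m)).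
      linear_maps K (sp (cmpt V m) (head (Q m) \<gamma>))
        (sp (cmpt V (Suc m)) (tail (Q (Suc m)) \<delta>)))}"

definition nrep_homs ::
    "('k, 'z) ring_scheme \<Rightarrow> nat \<Rightarrow> (nat \<Rightarrow> ('a, 'e) pre_digraph) \<Rightarrow>
     ('a, 'e, 'k, 'v) nqrep \<Rightarrow> ('a, 'e, 'k, 'v) nqrep \<Rightarrow>
     (nat \<Rightarrow> 'a \<Rightarrow> 'v \<Rightarrow> 'v) set" where
  "nrep_homs K n Q V W = {f \<in> (\<Pi>\<^sub>E m\<in>{1..n}. rep_homs K (Q m) (cmpt V m) (cmpt W m)).
    \<forall>m\<in>{1..<n}. \<forall>\<gamma>\<in>arcs (Q m). \<forall>\<delta>\<in>arcs (Q (Suc m)).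
      compose (carrier (sp (cmpt V m) (head (Q m) \<gamma>)))
        (f (Suc m) (tail (Q (Suc m)) \<delta>)) (lnk V m \<gamma> \<delta>) =
      compose (carrier (sp (cmpt V m) (head (Q m) \<gamma>)))
        (lnk W m \<gamma> \<delta>) (f m (head (Q m) \<gamma>))}"

definition nRep ::
    "('k, 'z) ring_scheme \<Rightarrow> nat \<Rightarrow> (nat \<Rightarrow> ('a, 'e) pre_digraph) \<Rightarrow>
     (('a, 'e, 'k, 'v) nqrep, nat \<Rightarrow> 'a \<Rightarrow> 'v \<Rightarrow> 'v) cat" where
  "nRep K n Q =
    \<lparr>Ob = nreps K n Q,
     Mor = nrep_homs K n Q,
     Idm = \<lambda>V. \<lambda>m\<in>{1..n}. Idm (Rep K (Q m)) (cmpt V m),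
     Cmp = \<lambda>U V W g f. \<lambda>m\<in>{1..n}.
       Cmp (Rep K (Q m)) (cmpt U m) (cmpt V m) (cmpt W m) (g m) (f m)\<rparr>"

definition fin_dim_nrep ::
    "('k, 'z) ring_scheme \<Rightarrow> nat \<Rightarrow> (nat \<Rightarrow> ('a, 'e) pre_digraph) \<Rightarrow>
     ('a, 'e, 'k, 'v) nqrep \<Rightarrow> bool" where
  "fin_dim_nrep K n Q V \<longleftrightarrow> (\<forall>m\<in>{1..n}. fin_dim_rep K (Q m) (cmpt V m))"

definition fd_nRep ::
    "('k, 'z) ring_scheme \<Rightarrow> nat \<Rightarrow> (nat \<Rightarrow> ('a, 'e) pre_digraph) \<Rightarrow>
     (('a, 'e, 'k, 'v) nqrep, nat \<Rightarrow> 'a \<Rightarrow> 'v \<Rightarrow> 'v) cat" where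
  "fd_nRep K n Q = full_subcat (nRep K n Q) (fin_dim_nrep K n Q)"


section \<open>The \<open>n\<close>-quiver\<close>

text \<open>
  \<open>Inner m \<alpha>\<close> is the arrow \<open>\<alpha>\<close> of \<open>Q m\<close>, and \<open>Link m \<gamma> \<delta>\<close> is the new arrow
  attached to \<open>\<gamma>\<close> in \<open>Q m\<close> and \<open>\<delta>\<close> in \<open>Q (Suc m)\<close>.
\<close>

datatype 'e narrow = Inner nat 'e | Link nat 'e 'e

definition nquiver ::
    "nat \<Rightarrow> (nat \<Rightarrow> ('a, 'e) pre_digraph) \<Rightarrow> (nat \<times> 'a, 'e narrow) pre_digraph" where
  "nquiver n Q =
    \<lparr>verts = (SIGMA m:{1..n}. verts (Q m)),
     arcs = {Inner m \<alpha> | m \<alpha>. m \<in> {1..n} \<and> \<alpha> \<in> arcs (Q m)} \<union>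
            {Link m \<gamma> \<delta> | m \<gamma> \<delta>. m \<in> {1..<n} \<and> \<gamma> \<in> arcs (Q m) \<and> \<delta> \<in> arcs (Q (Suc m))},
     tail = (\<lambda>a. case a of Inner m \<alpha> \<Rightarrow> (m, tail (Q m) \<alpha>)
                         | Link m \<gamma> \<delta> \<Rightarrow> (m, head (Q m) \<gamma>)),
     head = (\<lambda>a. case a of Inner m \<alpha> \<Rightarrow> (m, head (Q m) \<alpha>)
                         | Link m \<gamma> \<delta> \<Rightarrow> (Suc m, tail (Q (Suc m)) \<delta>))\<rparr>"

text \<open>
  \<^const>\<open>pre_digraph.cycle\<close> refers to directed cycles and includes loops;
  \<^const>\<open>Digraph_Component.connected\<close> refers to the underlying undirected graph, which it
  requires to be nonempty.
\<close>

definition acyclic_quiver :: "('a, 'e) pre_digraph \<Rightarrow> bool" where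
  "acyclic_quiver Q \<longleftrightarrow> (\<nexists>p. pre_digraph.cycle Q p)"

definition connected_quiver :: "('a, 'e) pre_digraph \<Rightarrow> bool" where
  "connected_quiver Q \<longleftrightarrow> Digraph_Component.connected Q"

end

theory Submission
  imports Defs
begin

text \<open>
  An arrow of the \<open>n\<close>-quiver either lies in one \<open>Q m\<close> or is a link from \<open>Q m\<close> to \<open>Q (Suc m)\<close>, and a
  linear map on a link is exactly one of the maps \<open>\<psi>\<^sub>m\<close> of an \<open>n\<close>-representation.  So an
  \<open>n\<close>-representation and a representation of the \<open>n\<close>-quiver are the same collection of vector spaces
  and linear maps, once indexed by pairs of a number and a vertex or arrow, once by the vertices and
  arrows of a disjoint union.  Likewise a morphism on either side is a family of linear maps, subject to
  one commuting square for each arrow of some \<open>Q m\<close> and one for each link.  Re-indexing is therefore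
  not merely an equivalence but an isomorphism of categories.

  The categorical part is the criterion \<open>cat_equivalence_bij\<close>: a functor that is bijective on objects
  and on each hom-set is an equivalence, because its set-theoretic inverse is a functor and
  identities then serve as unit and counit.  The representation-theoretic part checks that gluing is
  such a functor (\<open>cat_functor_glue\<close>, \<open>bij_betw_glue_rep\<close>, \<open>bij_betw_glue_hom\<close>); the inverse
  bijections are given explicitly by splitting.  Bijectivity can be literal because all families and
  linear maps are extensional.  As gluing does not change the vector spaces, it preserves and reflects
  finite dimensionality (\<open>fin_dim_glue_rep\<close>), which gives the restricted equivalence.
\<close>

section \<open>Equivalences from fully faithful functors that are bijective on objects\<close>

lemma (in category) is_iso_Idm: "x \<in> Ob C \<Longrightarrow> is_iso C x x (Idm C x)"
  unfolding is_iso_def using Idm_in Cmp_Idm_left by blast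

lemma (in category) cat_functor_id: "cat_functor C C id_fctr"
  by unfold_locales (simp_all add: id_fctr_def)

lemma cat_functor_comp:
  assumes "cat_functor C D F" "cat_functor D E G"
  shows "cat_functor C E (comp_fctr G F)"
proof -
  interpret F: cat_functor C D F by fact
  interpret G: cat_functor D E G by fact
  show ?thesis
    by unfold_locales
      (simp_all add: comp_fctr_def F.on_ob_in G.on_ob_in F.on_mor_in G.on_mor_in
        F.on_mor_Idm G.on_mor_Idm F.on_mor_Cmp G.on_mor_Cmp)
qed

text \<open>
  Functors that agree on the objects and morphisms of \<open>C\<close> may still differ as records, so the
  composites of a functor with its inverse are related to the identity functor by this natural
  isomorphism rather than by an equation.
\<close>

lemma natural_iso_Idm:
  assumes "cat_functor C D F" "cat_functor C D G"
    and ob: "\<And>x. x \<in> Ob C \<Longrightarrow> on_ob F x = on_ob G x"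
    and mor: "\<And>x y f. \<lbrakk>x \<in> Ob C; y \<in> Ob C; f \<in> Mor C x y\<rbrakk> \<Longrightarrow> on_mor F x y f = on_mor G x y f"
  shows "natural_iso C D F G (\<lambda>x. Idm D (on_ob G x))"
proof -
  interpret F: cat_functor C D F by fact
  interpret G: cat_functor C D G by fact
  show ?thesis
    by unfold_locales
      (simp_all add: ob mor F.D.is_iso_Idm G.on_ob_in G.on_mor_in F.D.Cmp_Idm_left F.D.Cmp_Idm_right)
qed

text \<open>
  The inverse on objects and hom-sets respects identities and composition because \<open>F\<close> does and is
  injective on each hom-set.
\<close>

lemma cat_equivalence_bij:
  assumes F: "cat_functor C D F"
    and ob: "bij_betw (on_ob F) (Ob C) (Ob D)"
    and mor: "\<And>x y. \<lbrakk>x \<in> Ob C; y \<in> Ob C\<rbrakk>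
      \<Longrightarrow> bij_betw (on_mor F x y) (Mor C x y) (Mor D (on_ob F x) (on_ob F y))"
  shows "cat_equivalence C D F"
proof -
  interpret F: cat_functor C D F by fact
  \<comment> \<open>The inverse on morphisms \<open>u \<rightarrow> v\<close> depends on \<open>u\<close> and \<open>v\<close>, as hom-sets need not be disjoint.\<close>
  define g where "g = inv_into (Ob C) (on_ob F)"
  define h where "h u v = inv_into (Mor C (g u) (g v)) (on_mor F (g u) (g v))" for u v
  define G where "G = \<lparr>on_ob = g, on_mor = h\<rparr>"
  have g_in: "g u \<in> Ob C" and Fg: "on_ob F (g u) = u" if "u \<in> Ob D" for u
    using that ob unfolding g_def bij_betw_def
    by (auto simp: inv_into_into f_inv_into_f)
  have gF: "g (on_ob F x) = x" if "x \<in> Ob C" for x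
    using that ob unfolding g_def bij_betw_def by simp
  have surj: "on_mor F (g u) (g v) ` Mor C (g u) (g v) = Mor D u v"
    if "u \<in> Ob D" "v \<in> Ob D" for u v
    using mor[OF g_in[OF that(1)] g_in[OF that(2)]] that
    by (simp add: Fg bij_betw_def)
  have h_in: "h u v f \<in> Mor C (g u) (g v)" and Fh: "on_mor F (g u) (g v) (h u v f) = f"
    if "u \<in> Ob D" "v \<in> Ob D" "f \<in> Mor D u v" for u v f
    using that surj[OF that(1,2)] unfolding h_def
    by (auto simp: inv_into_into f_inv_into_f)
  have hF: "h u v (on_mor F (g u) (g v) f) = f"
    if "u \<in> Ob D" "v \<in> Ob D" "f \<in> Mor C (g u) (g v)" for u v f
    using that mor[of "g u" "g v"] by (simp add: h_def g_in bij_betw_def)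
  have G: "cat_functor D C G"
  proof unfold_locales
    fix u assume u: "u \<in> Ob D"
    show "on_mor G u u (Idm D u) = Idm C (on_ob G u)"
      using hF[OF u u F.C.Idm_in[OF g_in[OF u]]] u
      by (simp add: G_def F.on_mor_Idm g_in Fg)
  next
    fix u v w a b
    assume *: "u \<in> Ob D" "v \<in> Ob D" "w \<in> Ob D" "a \<in> Mor D u v" "b \<in> Mor D v w"
    have "on_mor F (g u) (g w) (Cmp C (g u) (g v) (g w) (h v w b) (h u v a)) = Cmp D u v w b a"
      using * by (simp add: F.on_mor_Cmp g_in h_in Fh Fg)
    with * hF[of u w "Cmp C (g u) (g v) (g w) (h v w b) (h u v a)"]
    show "on_mor G u w (Cmp D u v w b a) =
        Cmp C (on_ob G u) (on_ob G v) (on_ob G w) (on_mor G v w b) (on_mor G u v a)"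
      by (simp add: G_def F.C.Cmp_in[where y = "g v"] g_in h_in)
  qed (simp_all add: G_def g_in h_in)
  have "\<exists>\<eta>. natural_iso C C id_fctr (comp_fctr G F) \<eta>"
  proof (rule exI, rule natural_iso_Idm[OF F.C.cat_functor_id cat_functor_comp[OF F G]])
    fix x y f assume *: "x \<in> Ob C" "y \<in> Ob C" "f \<in> Mor C x y"
    then show "on_mor id_fctr x y f = on_mor (comp_fctr G F) x y f"
      using hF[of "on_ob F x" "on_ob F y" f]
      by (simp add: id_fctr_def comp_fctr_def G_def F.on_ob_in gF)
  qed (simp add: id_fctr_def comp_fctr_def G_def gF)
  moreover have "\<exists>\<epsilon>. natural_iso D D (comp_fctr F G) id_fctr \<epsilon>"
    by (rule exI, rule natural_iso_Idm[OF cat_functor_comp[OF G F] F.D.cat_functor_id])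
      (simp_all add: id_fctr_def comp_fctr_def G_def Fg Fh)
  ultimately show ?thesis
    unfolding cat_equivalence_def using F G by blast
qed

lemma full_subcat_simps [simp]:
  "Ob (full_subcat C P) = {x \<in> Ob C. P x}"
  "Mor (full_subcat C P) = Mor C"
  "Idm (full_subcat C P) = Idm C"
  "Cmp (full_subcat C P) = Cmp C"
  by (simp_all add: full_subcat_def)

lemma (in category) category_full_subcat: "category (full_subcat C P)"
  by unfold_locales (auto simp: Idm_in Cmp_Idm_left Cmp_Idm_right intro: Cmp_in Cmp_assoc)

lemma (in cat_functor) cat_functor_full_subcat:
  assumes "\<And>x. x \<in> Ob C \<Longrightarrow> P x \<Longrightarrow> P' (on_ob F x)"
  shows "cat_functor (full_subcat C P) (full_subcat D P') F"
proof -
  interpret C': category "full_subcat C P" by (rule C.category_full_subcat)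
  interpret D': category "full_subcat D P'" by (rule D.category_full_subcat)
  show ?thesis
    by unfold_locales (auto simp: assms on_ob_in on_mor_in on_mor_Idm intro: on_mor_Cmp)
qed

text \<open>
  A full subcategory keeps the hom-sets, so the criterion passes to full subcategories as soon as
  their objects correspond; the functor itself stays the same.
\<close>

lemma cat_equivalence_bij_full_subcat:
  assumes F: "cat_functor C D F"
    and ob: "bij_betw (on_ob F) (Ob C) (Ob D)"
    and mor: "\<And>x y. \<lbrakk>x \<in> Ob C; y \<in> Ob C\<rbrakk>
      \<Longrightarrow> bij_betw (on_mor F x y) (Mor C x y) (Mor D (on_ob F x) (on_ob F y))"
    and P: "\<And>x. x \<in> Ob C \<Longrightarrow> P x \<longleftrightarrow> P' (on_ob F x)"
  shows "cat_equivalence (full_subcat C P) (full_subcat D P') F"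
proof (rule cat_equivalence_bij)
  interpret F: cat_functor C D F by fact
  show "cat_functor (full_subcat C P) (full_subcat D P') F"
    using P by (blast intro: F.cat_functor_full_subcat)
  show "bij_betw (on_ob F) (Ob (full_subcat C P)) (Ob (full_subcat D P'))"
    using P by (intro bij_betw_subset[OF ob]) (auto simp: bij_betw_imp_surj_on[OF ob, symmetric])
qed (use mor in auto)


section \<open>The categories of representations\<close>

lemma linear_maps_funcset: "f \<in> linear_maps K V W \<Longrightarrow> f \<in> carrier V \<rightarrow> carrier W"
  by (auto simp: linear_maps_def module_hom_def)

lemma id_in_linear_maps:
  assumes "vectorspace K V"
  shows "(\<lambda>x\<in>carrier V. x) \<in> linear_maps K V V"
proof -
  interpret vectorspace K V by fact
  show ?thesis by (auto simp: linear_maps_def module_hom_def)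
qed

lemma compose_in_linear_maps:
  assumes "vectorspace K U" "f \<in> linear_maps K U V" "g \<in> linear_maps K V W"
  shows "compose (carrier U) g f \<in> linear_maps K U W"
proof -
  interpret vectorspace K U by fact
  show ?thesis
    using assms(2,3) by (auto simp: linear_maps_def module_hom_def compose_def Pi_iff)
qed

lemma compose_id_left: "f \<in> linear_maps K V W \<Longrightarrow> compose (carrier V) (\<lambda>x\<in>carrier W. x) f = f"
  by (rule Id_compose) (auto simp: linear_maps_def module_hom_def)

lemma compose_id_right: "f \<in> linear_maps K V W \<Longrightarrow> compose (carrier V) f (\<lambda>x\<in>carrier V. x) = f"
  by (rule compose_Id) (auto simp: linear_maps_def module_hom_def)

lemma id_square:
  assumes "s \<in> A \<rightarrow> B"
  shows "compose A (\<lambda>x\<in>B. x) s = compose A s (\<lambda>x\<in>A. x)"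
  using assms by (auto simp: compose_def Pi_iff intro!: restrict_ext)

text \<open>
  Two commuting squares, side by side with common edge \<open>t\<close>, have a commuting outer rectangle.  Both
  the squares over the arrows of a quiver and those over the links of an \<open>n\<close>-representation compose for
  this reason.
\<close>

lemma paste_squares:
  assumes "compose A f' s = compose A t f" "compose B g' t = compose B u g"
    and "f \<in> A \<rightarrow> B" "s \<in> A \<rightarrow> A'"
  shows "compose A (compose A' g' f') s = compose A u (compose A g f)"
proof
  fix x
  show "compose A (compose A' g' f') s x = compose A u (compose A g f) x"
    using fun_cong[OF assms(1), of x] fun_cong[OF assms(2), of "f x"] assms(3,4)
    by (cases "x \<in> A") (auto simp: compose_def Pi_iff)
qed

lemma Rep_simps [simp]:
  "Ob (Rep K Q) = reps K Q"
  "Mor (Rep K Q) = rep_homs K Q"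
  "Idm (Rep K Q) = (\<lambda>M. \<lambda>i\<in>verts Q. \<lambda>x\<in>carrier (sp M i). x)"
  "Cmp (Rep K Q) = (\<lambda>L M N g f. \<lambda>i\<in>verts Q. compose (carrier (sp L i)) (g i) (f i))"
  by (simp_all add: Rep_def)

lemma reps_sp: "M \<in> reps K Q \<Longrightarrow> i \<in> verts Q \<Longrightarrow> vectorspace K (sp M i)"
  by (auto simp: reps_def)

lemma reps_str:
  "M \<in> reps K Q \<Longrightarrow> \<alpha> \<in> arcs Q \<Longrightarrow> str M \<alpha> \<in> linear_maps K (sp M (tail Q \<alpha>)) (sp M (head Q \<alpha>))"
  by (auto simp: reps_def)

lemma rep_homs_in:
  "f \<in> rep_homs K Q M N \<Longrightarrow> i \<in> verts Q \<Longrightarrow> f i \<in> linear_maps K (sp M i) (sp N i)"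
  by (auto simp: rep_homs_def)

lemma rep_homs_square:
  "f \<in> rep_homs K Q M N \<Longrightarrow> \<alpha> \<in> arcs Q \<Longrightarrow>
    compose (carrier (sp M (tail Q \<alpha>))) (f (head Q \<alpha>)) (str M \<alpha>) =
    compose (carrier (sp M (tail Q \<alpha>))) (str N \<alpha>) (f (tail Q \<alpha>))"
  by (auto simp: rep_homs_def)

lemma category_Rep:
  fixes K :: "('k, 'z) ring_scheme"
  assumes "wf_digraph Q"
  shows "category (Rep K Q :: (('a, 'e, 'k, 'v) qrep, _) cat)"
proof -
  interpret wf_digraph Q by fact
  show ?thesis
  proof unfold_locales
    fix M :: "('a, 'e, 'k, 'v) qrep" assume "M \<in> Ob (Rep K Q)"
    then show "Idm (Rep K Q) M \<in> Mor (Rep K Q) M M"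
      by (auto simp: rep_homs_def reps_sp id_in_linear_maps
          intro!: id_square linear_maps_funcset reps_str)
  next
    fix L M N :: "('a, 'e, 'k, 'v) qrep" and f g
    assume "L \<in> Ob (Rep K Q)" "M \<in> Ob (Rep K Q)" "N \<in> Ob (Rep K Q)"
      and "f \<in> Mor (Rep K Q) L M" "g \<in> Mor (Rep K Q) M N"
    then have *: "L \<in> reps K Q" "f \<in> rep_homs K Q L M" "g \<in> rep_homs K Q M N"
      by simp_all
    have "(\<lambda>i\<in>verts Q. compose (carrier (sp L i)) (g i) (f i)) \<in> rep_homs K Q L N"
      unfolding rep_homs_def
    proof (intro CollectI conjI ballI)
      show "(\<lambda>i\<in>verts Q. compose (carrier (sp L i)) (g i) (f i))
          \<in> (\<Pi>\<^sub>E i\<in>verts Q. linear_maps K (sp L i) (sp N i))"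
        using * by (auto intro: compose_in_linear_maps reps_sp rep_homs_in)
    next
      fix \<alpha> assume \<alpha>: "\<alpha> \<in> arcs Q"
      then show "compose (carrier (sp L (tail Q \<alpha>)))
            ((\<lambda>i\<in>verts Q. compose (carrier (sp L i)) (g i) (f i)) (head Q \<alpha>)) (str L \<alpha>) =
          compose (carrier (sp L (tail Q \<alpha>))) (str N \<alpha>)
            ((\<lambda>i\<in>verts Q. compose (carrier (sp L i)) (g i) (f i)) (tail Q \<alpha>))"
        using paste_squares[OF rep_homs_square[OF *(2) \<alpha>] rep_homs_square[OF *(3) \<alpha>]
            linear_maps_funcset[OF rep_homs_in[OF *(2)]] linear_maps_funcset[OF reps_str[OF *(1) \<alpha>]]]
        by simp
    qed
    then show "Cmp (Rep K Q) L M N g f \<in> Mor (Rep K Q) L N" by simp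
  next
    fix M N :: "('a, 'e, 'k, 'v) qrep" and f
    assume "f \<in> Mor (Rep K Q) M N"
    then show "Cmp (Rep K Q) M N N (Idm (Rep K Q) N) f = f"
      by (auto simp: fun_eq_iff restrict_def rep_homs_def PiE_iff extensional_def
          intro: compose_id_left[THEN fun_cong, unfolded restrict_def])
  next
    fix M N :: "('a, 'e, 'k, 'v) qrep" and f
    assume "f \<in> Mor (Rep K Q) M N"
    then show "Cmp (Rep K Q) M M N f (Idm (Rep K Q) M) = f"
      by (auto simp: fun_eq_iff restrict_def rep_homs_def PiE_iff extensional_def
          intro: compose_id_right[THEN fun_cong, unfolded restrict_def])
  next
    fix L M N P :: "('a, 'e, 'k, 'v) qrep" and f g h
    assume "f \<in> Mor (Rep K Q) L M"
    then show "Cmp (Rep K Q) L N P h (Cmp (Rep K Q) L M N g f) =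
        Cmp (Rep K Q) L M P (Cmp (Rep K Q) M N P h g) f"
      by (auto intro!: restrict_ext compose_assoc linear_maps_funcset rep_homs_in)
  qed
qed

lemma nRep_simps [simp]:
  "Ob (nRep K n Q) = nreps K n Q"
  "Mor (nRep K n Q) = nrep_homs K n Q"
  "Idm (nRep K n Q) = (\<lambda>V. \<lambda>m\<in>{1..n}. Idm (Rep K (Q m)) (cmpt V m))"
  "Cmp (nRep K n Q) = (\<lambda>U V W g f. \<lambda>m\<in>{1..n}.
     Cmp (Rep K (Q m)) (cmpt U m) (cmpt V m) (cmpt W m) (g m) (f m))"
  by (simp_all add: nRep_def)

lemma nreps_cmpt: "V \<in> nreps K n Q \<Longrightarrow> m \<in> {1..n} \<Longrightarrow> cmpt V m \<in> reps K (Q m)"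
  by (auto simp: nreps_def)

lemma nreps_lnk:
  "V \<in> nreps K n Q \<Longrightarrow> m \<in> {1..<n} \<Longrightarrow> \<gamma> \<in> arcs (Q m) \<Longrightarrow> \<delta> \<in> arcs (Q (Suc m)) \<Longrightarrow>
    lnk V m \<gamma> \<delta> \<in> linear_maps K (sp (cmpt V m) (head (Q m) \<gamma>))
      (sp (cmpt V (Suc m)) (tail (Q (Suc m)) \<delta>))"
  unfolding nreps_def by fast

lemma nrep_homs_in:
  "f \<in> nrep_homs K n Q V W \<Longrightarrow> m \<in> {1..n} \<Longrightarrow> f m \<in> rep_homs K (Q m) (cmpt V m) (cmpt W m)"
  by (auto simp: nrep_homs_def)

lemma nrep_homs_square:
  "f \<in> nrep_homs K n Q V W \<Longrightarrow> m \<in> {1..<n} \<Longrightarrow> \<gamma> \<in> arcs (Q m) \<Longrightarrow> \<delta> \<in> arcs (Q (Suc m)) \<Longrightarrow>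
    compose (carrier (sp (cmpt V m) (head (Q m) \<gamma>)))
      (f (Suc m) (tail (Q (Suc m)) \<delta>)) (lnk V m \<gamma> \<delta>) =
    compose (carrier (sp (cmpt V m) (head (Q m) \<gamma>)))
      (lnk W m \<gamma> \<delta>) (f m (head (Q m) \<gamma>))"
  unfolding nrep_homs_def by fast

text \<open>
  The category laws hold in each component because they hold in \<open>Rep K (Q m)\<close>; only the squares over
  the links need an argument.
\<close>

lemma category_nRep:
  fixes K :: "('k, 'z) ring_scheme" and Q :: "nat \<Rightarrow> ('a, 'e) pre_digraph"
  assumes wf: "\<And>m. m \<in> {1..n} \<Longrightarrow> wf_digraph (Q m)"
  shows "category (nRep K n Q :: (('a, 'e, 'k, 'v) nqrep, _) cat)"
proof -
  have cat: "category (Rep K (Q m) :: (('a, 'e, 'k, 'v) qrep, _) cat)" if "m \<in> {1..n}" for m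
    using that by (intro category_Rep wf)
  note ends = wf_digraph.head_in_verts[OF wf] wf_digraph.tail_in_verts[OF wf]
  show ?thesis
  proof unfold_locales
    fix V :: "('a, 'e, 'k, 'v) nqrep" assume V: "V \<in> Ob (nRep K n Q)"
    then have "Idm (nRep K n Q) V m \<in> rep_homs K (Q m) (cmpt V m) (cmpt V m)"
      if "m \<in> {1..n}" for m
      using category.Idm_in[OF cat[OF that], of "cmpt V m"] that nreps_cmpt[of V K n Q m]
      by simp
    with V show "Idm (nRep K n Q) V \<in> Mor (nRep K n Q) V V"
      by (auto simp: nrep_homs_def ends intro!: id_square linear_maps_funcset nreps_lnk)
  next
    fix U V W :: "('a, 'e, 'k, 'v) nqrep" and f g
    assume "U \<in> Ob (nRep K n Q)" "V \<in> Ob (nRep K n Q)" "W \<in> Ob (nRep K n Q)"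
      and "f \<in> Mor (nRep K n Q) U V" "g \<in> Mor (nRep K n Q) V W"
    then have *: "U \<in> nreps K n Q" "V \<in> nreps K n Q" "W \<in> nreps K n Q"
        "f \<in> nrep_homs K n Q U V" "g \<in> nrep_homs K n Q V W"
      by simp_all
    have "Cmp (nRep K n Q) U V W g f \<in> nrep_homs K n Q U W"
      unfolding nrep_homs_def
    proof (intro CollectI conjI ballI)
      have "Cmp (Rep K (Q m)) (cmpt U m) (cmpt V m) (cmpt W m) (g m) (f m)
          \<in> rep_homs K (Q m) (cmpt U m) (cmpt W m)" if "m \<in> {1..n}" for m
        using category.Cmp_in[OF cat[OF that], of "cmpt U m" "cmpt V m" "cmpt W m" "f m" "g m"]
          that * by (simp add: nreps_cmpt nrep_homs_in)
      then show "Cmp (nRep K n Q) U V W g f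
          \<in> (\<Pi>\<^sub>E m\<in>{1..n}. rep_homs K (Q m) (cmpt U m) (cmpt W m))"
        by (simp del: Rep_simps)
    next
      fix m \<gamma> \<delta>
      assume m: "m \<in> {1..<n}" and arcs: "\<gamma> \<in> arcs (Q m)" "\<delta> \<in> arcs (Q (Suc m))"
      have "f m (head (Q m) \<gamma>) \<in> carrier (sp (cmpt U m) (head (Q m) \<gamma>)) \<rightarrow>
          carrier (sp (cmpt V m) (head (Q m) \<gamma>))"
        using * m arcs by (auto intro!: linear_maps_funcset rep_homs_in nrep_homs_in ends)
      then show "compose (carrier (sp (cmpt U m) (head (Q m) \<gamma>)))
          (Cmp (nRep K n Q) U V W g f (Suc m) (tail (Q (Suc m)) \<delta>)) (lnk U m \<gamma> \<delta>) =
        compose (carrier (sp (cmpt U m) (head (Q m) \<gamma>)))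
          (lnk W m \<gamma> \<delta>) (Cmp (nRep K n Q) U V W g f m (head (Q m) \<gamma>))"
        using paste_squares[OF nrep_homs_square[OF *(4) m arcs] nrep_homs_square[OF *(5) m arcs] _
            linear_maps_funcset[OF nreps_lnk[OF *(1) m arcs]]] m arcs
        by (simp add: ends)
    qed
    then show "Cmp (nRep K n Q) U V W g f \<in> Mor (nRep K n Q) U W" by simp
  next
    fix V W :: "('a, 'e, 'k, 'v) nqrep" and f
    assume *: "V \<in> Ob (nRep K n Q)" "W \<in> Ob (nRep K n Q)" "f \<in> Mor (nRep K n Q) V W"
    have "Cmp (Rep K (Q m)) (cmpt V m) (cmpt W m) (cmpt W m)
        (Idm (Rep K (Q m)) (cmpt W m)) (f m) = f m" if "m \<in> {1..n}" for m
      using * that by (intro category.Cmp_Idm_left[OF cat]) (simp_all add: nreps_cmpt nrep_homs_in)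
    moreover have "f \<in> extensional {1..n}" using * by (simp add: nrep_homs_def PiE_def)
    ultimately show "Cmp (nRep K n Q) V W W (Idm (nRep K n Q) W) f = f"
      by (auto simp: fun_eq_iff extensional_def simp del: Rep_simps)
  next
    fix V W :: "('a, 'e, 'k, 'v) nqrep" and f
    assume *: "V \<in> Ob (nRep K n Q)" "W \<in> Ob (nRep K n Q)" "f \<in> Mor (nRep K n Q) V W"
    have "Cmp (Rep K (Q m)) (cmpt V m) (cmpt V m) (cmpt W m)
        (f m) (Idm (Rep K (Q m)) (cmpt V m)) = f m" if "m \<in> {1..n}" for m
      using * that by (intro category.Cmp_Idm_right[OF cat]) (simp_all add: nreps_cmpt nrep_homs_in)
    moreover have "f \<in> extensional {1..n}" using * by (simp add: nrep_homs_def PiE_def)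
    ultimately show "Cmp (nRep K n Q) V V W f (Idm (nRep K n Q) V) = f"
      by (auto simp: fun_eq_iff extensional_def simp del: Rep_simps)
  next
    fix U V W T :: "('a, 'e, 'k, 'v) nqrep" and f g h
    assume "U \<in> Ob (nRep K n Q)" "V \<in> Ob (nRep K n Q)" "W \<in> Ob (nRep K n Q)"
      "T \<in> Ob (nRep K n Q)" "f \<in> Mor (nRep K n Q) U V" "g \<in> Mor (nRep K n Q) V W"
      "h \<in> Mor (nRep K n Q) W T"
    then show "Cmp (nRep K n Q) U W T h (Cmp (nRep K n Q) U V W g f) =
        Cmp (nRep K n Q) U V T (Cmp (nRep K n Q) V W T h g) f"
      by (auto simp del: Rep_simps intro!: restrict_ext category.Cmp_assoc[OF cat])
        (simp_all add: nreps_cmpt nrep_homs_in)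
  qed
qed


section \<open>Gluing \<open>n\<close>-representations along the linking maps\<close>

lemma nquiver_simps [simp]:
  "verts (nquiver n Q) = (SIGMA m:{1..n}. verts (Q m))"
  "Inner m \<alpha> \<in> arcs (nquiver n Q) \<longleftrightarrow> m \<in> {1..n} \<and> \<alpha> \<in> arcs (Q m)"
  "Link m \<gamma> \<delta> \<in> arcs (nquiver n Q) \<longleftrightarrow>
     m \<in> {1..<n} \<and> \<gamma> \<in> arcs (Q m) \<and> \<delta> \<in> arcs (Q (Suc m))"
  "tail (nquiver n Q) (Inner m \<alpha>) = (m, tail (Q m) \<alpha>)"
  "head (nquiver n Q) (Inner m \<alpha>) = (m, head (Q m) \<alpha>)"
  "tail (nquiver n Q) (Link m \<gamma> \<delta>) = (m, head (Q m) \<gamma>)"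
  "head (nquiver n Q) (Link m \<gamma> \<delta>) = (Suc m, tail (Q (Suc m)) \<delta>)"
  by (auto simp: nquiver_def)

text \<open>
  This splits a condition on the \<open>n\<close>-quiver, such as the commuting squares of a morphism, into the
  conditions inside the quivers and the conditions on the links, which is how the definitions for
  \<open>n\<close>-representations are organised.
\<close>

lemma ball_arcs_nquiver:
  "(\<forall>a\<in>arcs (nquiver n Q). P a) \<longleftrightarrow>
    (\<forall>m\<in>{1..n}. \<forall>\<alpha>\<in>arcs (Q m). P (Inner m \<alpha>)) \<and>
    (\<forall>m\<in>{1..<n}. \<forall>\<gamma>\<in>arcs (Q m). \<forall>\<delta>\<in>arcs (Q (Suc m)). P (Link m \<gamma> \<delta>))"
  by (fastforce simp: nquiver_def)

lemma wf_digraph_nquiver: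
  assumes "\<And>m. m \<in> {1..n} \<Longrightarrow> wf_digraph (Q m)"
  shows "wf_digraph (nquiver n Q)"
proof -
  note ends = wf_digraph.head_in_verts[OF assms] wf_digraph.tail_in_verts[OF assms]
  have "\<forall>a\<in>arcs (nquiver n Q). tail (nquiver n Q) a \<in> verts (nquiver n Q) \<and>
      head (nquiver n Q) a \<in> verts (nquiver n Q)"
    unfolding ball_arcs_nquiver by (auto simp: ends)
  then show ?thesis by (auto simp: wf_digraph_def)
qed

definition glue_rep ::
    "nat \<Rightarrow> (nat \<Rightarrow> ('a, 'e) pre_digraph) \<Rightarrow> ('a, 'e, 'k, 'v) nqrep \<Rightarrow>
     (nat \<times> 'a, 'e narrow, 'k, 'v) qrep" where
  "glue_rep n Q V =
    \<lparr>sp = \<lambda>(m, i)\<in>verts (nquiver n Q). sp (cmpt V m) i,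
     str = \<lambda>a\<in>arcs (nquiver n Q). case a of Inner m \<alpha> \<Rightarrow> str (cmpt V m) \<alpha>
                                            | Link m \<gamma> \<delta> \<Rightarrow> lnk V m \<gamma> \<delta>\<rparr>"

definition split_rep ::
    "nat \<Rightarrow> (nat \<Rightarrow> ('a, 'e) pre_digraph) \<Rightarrow> (nat \<times> 'a, 'e narrow, 'k, 'v) qrep \<Rightarrow>
     ('a, 'e, 'k, 'v) nqrep" where
  "split_rep n Q M =
    \<lparr>cmpt = \<lambda>m\<in>{1..n}. \<lparr>sp = \<lambda>i\<in>verts (Q m). sp M (m, i),
                         str = \<lambda>\<alpha>\<in>arcs (Q m). str M (Inner m \<alpha>)\<rparr>,
     lnk = \<lambda>m\<in>{1..<n}. \<lambda>\<gamma>\<in>arcs (Q m). \<lambda>\<delta>\<in>arcs (Q (Suc m)). str M (Link m \<gamma> \<delta>)\<rparr>"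

definition glue_hom ::
    "nat \<Rightarrow> (nat \<Rightarrow> ('a, 'e) pre_digraph) \<Rightarrow> (nat \<Rightarrow> 'a \<Rightarrow> 'v \<Rightarrow> 'v) \<Rightarrow> nat \<times> 'a \<Rightarrow> 'v \<Rightarrow> 'v" where
  "glue_hom n Q f = (\<lambda>(m, i)\<in>verts (nquiver n Q). f m i)"

definition split_hom ::
    "nat \<Rightarrow> (nat \<Rightarrow> ('a, 'e) pre_digraph) \<Rightarrow> (nat \<times> 'a \<Rightarrow> 'v \<Rightarrow> 'v) \<Rightarrow> nat \<Rightarrow> 'a \<Rightarrow> 'v \<Rightarrow> 'v" where
  "split_hom n Q g = (\<lambda>m\<in>{1..n}. \<lambda>i\<in>verts (Q m). g (m, i))"

definition glue_fctr ::
    "nat \<Rightarrow> (nat \<Rightarrow> ('a, 'e) pre_digraph) \<Rightarrow>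
     (('a, 'e, 'k, 'v) nqrep, nat \<Rightarrow> 'a \<Rightarrow> 'v \<Rightarrow> 'v,
      (nat \<times> 'a, 'e narrow, 'k, 'v) qrep, nat \<times> 'a \<Rightarrow> 'v \<Rightarrow> 'v) fctr" where
  "glue_fctr n Q = \<lparr>on_ob = glue_rep n Q, on_mor = \<lambda>V W. glue_hom n Q\<rparr>"

lemma glue_rep_simps [simp]:
  "m \<in> {1..n} \<Longrightarrow> i \<in> verts (Q m) \<Longrightarrow> sp (glue_rep n Q V) (m, i) = sp (cmpt V m) i"
  "m \<in> {1..n} \<Longrightarrow> \<alpha> \<in> arcs (Q m) \<Longrightarrow> str (glue_rep n Q V) (Inner m \<alpha>) = str (cmpt V m) \<alpha>"
  "m \<in> {1..<n} \<Longrightarrow> \<gamma> \<in> arcs (Q m) \<Longrightarrow> \<delta> \<in> arcs (Q (Suc m)) \<Longrightarrow>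
    str (glue_rep n Q V) (Link m \<gamma> \<delta>) = lnk V m \<gamma> \<delta>"
  by (simp_all add: glue_rep_def)

lemma split_rep_simps [simp]:
  "m \<in> {1..n} \<Longrightarrow> i \<in> verts (Q m) \<Longrightarrow> sp (cmpt (split_rep n Q M) m) i = sp M (m, i)"
  "m \<in> {1..n} \<Longrightarrow> \<alpha> \<in> arcs (Q m) \<Longrightarrow> str (cmpt (split_rep n Q M) m) \<alpha> = str M (Inner m \<alpha>)"
  "m \<in> {1..<n} \<Longrightarrow> \<gamma> \<in> arcs (Q m) \<Longrightarrow> \<delta> \<in> arcs (Q (Suc m)) \<Longrightarrow>
    lnk (split_rep n Q M) m \<gamma> \<delta> = str M (Link m \<gamma> \<delta>)"
  by (simp_all add: split_rep_def)

lemma glue_hom_simp [simp]: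
  "m \<in> {1..n} \<Longrightarrow> i \<in> verts (Q m) \<Longrightarrow> glue_hom n Q f (m, i) = f m i"
  by (simp add: glue_hom_def)

lemma split_hom_simp [simp]:
  "m \<in> {1..n} \<Longrightarrow> i \<in> verts (Q m) \<Longrightarrow> split_hom n Q g m i = g (m, i)"
  by (simp add: split_hom_def)

context
  fixes K :: "('k, 'z) ring_scheme" and n :: nat and Q :: "nat \<Rightarrow> ('a, 'e) pre_digraph"
  assumes wf: "\<And>m. m \<in> {1..n} \<Longrightarrow> wf_digraph (Q m)"
begin

lemmas head_tail_in_verts [simp] =
  wf_digraph.head_in_verts[OF wf] wf_digraph.tail_in_verts[OF wf]

lemma glue_rep_in:
  fixes V :: "('a, 'e, 'k, 'v) nqrep"
  assumes V: "V \<in> nreps K n Q"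
  shows "glue_rep n Q V \<in> reps K (nquiver n Q)"
proof -
  have "\<forall>a\<in>arcs (nquiver n Q). str (glue_rep n Q V) a \<in> linear_maps K
      (sp (glue_rep n Q V) (tail (nquiver n Q) a)) (sp (glue_rep n Q V) (head (nquiver n Q) a))"
    unfolding ball_arcs_nquiver
    using reps_str[OF nreps_cmpt[OF V]] nreps_lnk[OF V] by simp
  moreover have "str (glue_rep n Q V) \<in> extensional (arcs (nquiver n Q))"
    by (simp add: glue_rep_def)
  moreover have "sp (glue_rep n Q V) \<in> verts (nquiver n Q) \<rightarrow>\<^sub>E {V. vectorspace K V}"
    using reps_sp[OF nreps_cmpt[OF V]] by (auto simp: glue_rep_def)
  ultimately show ?thesis by (auto simp: reps_def PiE_iff)
qed

lemma split_rep_in: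
  fixes M :: "(nat \<times> 'a, 'e narrow, 'k, 'v) qrep"
  assumes M: "M \<in> reps K (nquiver n Q)"
  shows "split_rep n Q M \<in> nreps K n Q"
proof -
  have "cmpt (split_rep n Q M) m \<in> reps K (Q m)" if "m \<in> {1..n}" for m
    using that reps_sp[OF M, of "(m, _)"] reps_str[OF M, of "Inner m _"]
    by (auto simp: reps_def split_rep_def)
  moreover have "lnk (split_rep n Q M) m \<gamma> \<delta> \<in>
      linear_maps K (sp (cmpt (split_rep n Q M) m) (head (Q m) \<gamma>))
        (sp (cmpt (split_rep n Q M) (Suc m)) (tail (Q (Suc m)) \<delta>))"
    if "m \<in> {1..<n}" "\<gamma> \<in> arcs (Q m)" "\<delta> \<in> arcs (Q (Suc m))" for m \<gamma> \<delta>
    using that reps_str[OF M, of "Link m \<gamma> \<delta>"] by simp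
  ultimately show ?thesis
    by (auto simp: nreps_def PiE_iff) (auto simp: split_rep_def)
qed

lemma split_glue_rep:
  fixes V :: "('a, 'e, 'k, 'v) nqrep"
  assumes V: "V \<in> nreps K n Q"
  shows "split_rep n Q (glue_rep n Q V) = V"
proof -
  have "cmpt (split_rep n Q (glue_rep n Q V)) m = cmpt V m" for m
  proof (cases "m \<in> {1..n}")
    case True
    with nreps_cmpt[OF V True] show ?thesis
      by (auto simp: split_rep_def reps_def PiE_iff extensional_def intro!: qrep.equality)
  next
    case False
    with V show ?thesis by (auto simp: split_rep_def nreps_def PiE_iff extensional_def)
  qed
  moreover have "lnk (split_rep n Q (glue_rep n Q V)) = lnk V"
    using V by (auto simp: split_rep_def nreps_def PiE_iff extensional_def fun_eq_iff)
  ultimately show ?thesis by (intro nqrep.equality) auto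
qed

lemma glue_split_rep:
  fixes M :: "(nat \<times> 'a, 'e narrow, 'k, 'v) qrep"
  assumes M: "M \<in> reps K (nquiver n Q)"
  shows "glue_rep n Q (split_rep n Q M) = M"
proof -
  have "\<forall>a\<in>arcs (nquiver n Q). str (glue_rep n Q (split_rep n Q M)) a = str M a"
    unfolding ball_arcs_nquiver by simp
  then have "str (glue_rep n Q (split_rep n Q M)) a = str M a" for a
    using M by (cases "a \<in> arcs (nquiver n Q)") (auto simp: glue_rep_def reps_def)
  moreover have "sp (glue_rep n Q (split_rep n Q M)) x = sp M x" for x
    using M by (cases x, cases "x \<in> verts (nquiver n Q)")
      (auto simp: glue_rep_def reps_def PiE_iff extensional_def)
  ultimately show ?thesis by (intro qrep.equality) auto
qed

lemma bij_betw_glue_rep: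
  "bij_betw (glue_rep n Q)
    (nreps K n Q :: ('a, 'e, 'k, 'v) nqrep set) (reps K (nquiver n Q))"
  by (rule bij_betw_byWitness[where f' = "split_rep n Q"])
    (auto simp: split_glue_rep glue_split_rep glue_rep_in split_rep_in)

lemma glue_hom_in:
  assumes f: "f \<in> nrep_homs K n Q V W"
  shows "glue_hom n Q f \<in> rep_homs K (nquiver n Q) (glue_rep n Q V) (glue_rep n Q W)"
  unfolding rep_homs_def ball_arcs_nquiver
  using rep_homs_in[OF nrep_homs_in[OF f]] rep_homs_square[OF nrep_homs_in[OF f]]
    nrep_homs_square[OF f]
  by (auto simp: PiE_iff) (auto simp: glue_hom_def)

lemma split_hom_in:
  assumes g: "g \<in> rep_homs K (nquiver n Q) (glue_rep n Q V) (glue_rep n Q W)"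
  shows "split_hom n Q g \<in> nrep_homs K n Q V W"
proof -
  have "split_hom n Q g m \<in> rep_homs K (Q m) (cmpt V m) (cmpt W m)" if "m \<in> {1..n}" for m
    using that rep_homs_in[OF g, of "(m, _)"] rep_homs_square[OF g, of "Inner m _"]
    by (auto simp: rep_homs_def split_hom_def)
  moreover have "compose (carrier (sp (cmpt V m) (head (Q m) \<gamma>)))
        (split_hom n Q g (Suc m) (tail (Q (Suc m)) \<delta>)) (lnk V m \<gamma> \<delta>) =
      compose (carrier (sp (cmpt V m) (head (Q m) \<gamma>)))
        (lnk W m \<gamma> \<delta>) (split_hom n Q g m (head (Q m) \<gamma>))"
    if "m \<in> {1..<n}" "\<gamma> \<in> arcs (Q m)" "\<delta> \<in> arcs (Q (Suc m))" for m \<gamma> \<delta>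
    using that rep_homs_square[OF g, of "Link m \<gamma> \<delta>"] by simp
  ultimately show ?thesis
    by (auto simp: nrep_homs_def PiE_iff) (auto simp: split_hom_def)
qed

lemma bij_betw_glue_hom:
  "bij_betw (glue_hom n Q) (nrep_homs K n Q V W)
    (rep_homs K (nquiver n Q) (glue_rep n Q V) (glue_rep n Q W))"
proof (rule bij_betw_byWitness[where f' = "split_hom n Q"])
  show "\<forall>f\<in>nrep_homs K n Q V W. split_hom n Q (glue_hom n Q f) = f"
    by (auto simp: split_hom_def nrep_homs_def rep_homs_def PiE_iff extensional_def fun_eq_iff)
  show "\<forall>g\<in>rep_homs K (nquiver n Q) (glue_rep n Q V) (glue_rep n Q W).
      glue_hom n Q (split_hom n Q g) = g"
    by (auto simp: glue_hom_def rep_homs_def PiE_iff extensional_def fun_eq_iff)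
qed (auto simp: glue_hom_in split_hom_in)

lemma cat_functor_glue:
  "cat_functor (nRep K n Q) (Rep K (nquiver n Q) :: (_, nat \<times> 'a \<Rightarrow> 'v \<Rightarrow> 'v) cat) (glue_fctr n Q)"
proof -
  interpret C: category "nRep K n Q :: (('a, 'e, 'k, 'v) nqrep, _) cat"
    by (rule category_nRep[OF wf])
  interpret D: category "Rep K (nquiver n Q) :: ((nat \<times> 'a, 'e narrow, 'k, 'v) qrep, _) cat"
    by (rule category_Rep[OF wf_digraph_nquiver[OF wf]])
  show ?thesis
    by unfold_locales
      (auto simp: glue_fctr_def glue_rep_in glue_hom_in, auto simp: glue_hom_def)
qed

lemma fin_dim_glue_rep: "fin_dim_rep K (nquiver n Q) (glue_rep n Q V) \<longleftrightarrow> fin_dim_nrep K n Q V"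
  by (auto simp: fin_dim_rep_def fin_dim_nrep_def)

lemma cat_equivalence_glue:
  "cat_equivalence (nRep K n Q) (Rep K (nquiver n Q) :: (_, nat \<times> 'a \<Rightarrow> 'v \<Rightarrow> 'v) cat) (glue_fctr n Q)"
  by (rule cat_equivalence_bij[OF cat_functor_glue])
    (simp_all add: glue_fctr_def bij_betw_glue_rep bij_betw_glue_hom)

lemma cat_equivalence_fd_glue:
  "cat_equivalence (fd_nRep K n Q) (fd_Rep K (nquiver n Q) :: (_, nat \<times> 'a \<Rightarrow> 'v \<Rightarrow> 'v) cat)
    (glue_fctr n Q)"
  unfolding fd_nRep_def fd_Rep_def
  by (rule cat_equivalence_bij_full_subcat[OF cat_functor_glue])
    (simp_all add: glue_fctr_def bij_betw_glue_rep bij_betw_glue_hom fin_dim_glue_rep)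

end


section \<open>The equivalence\<close>

theorem proposition5p5:
  fixes K :: "('k, 'z) ring_scheme"
    and n :: nat
    and Q :: "nat \<Rightarrow> ('a, 'e) pre_digraph"
  assumes "algebraically_closed K"
    and "n \<ge> 2"
    and "\<And>m. m \<in> {1..n} \<Longrightarrow> fin_digraph (Q m)"
    and "\<And>m. m \<in> {1..n} \<Longrightarrow> connected_quiver (Q m)"
    and "\<And>m. m \<in> {1..n} \<Longrightarrow> acyclic_quiver (Q m)"
  shows "\<exists>F :: (('a, 'e, 'k, 'v) nqrep, nat \<Rightarrow> 'a \<Rightarrow> 'v \<Rightarrow> 'v,
                (nat \<times> 'a, 'e narrow, 'k, 'v) qrep, nat \<times> 'a \<Rightarrow> 'v \<Rightarrow> 'v) fctr.
           cat_equivalence (nRep K n Q) (Rep K (nquiver n Q)) F \<and>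
           cat_equivalence (fd_nRep K n Q) (fd_Rep K (nquiver n Q)) F"
proof (intro exI conjI)
  have wf: "wf_digraph (Q m)" if "m \<in> {1..n}" for m
    using assms(3)[OF that] by (rule fin_digraph.axioms(1))
  show "cat_equivalence (nRep K n Q)
      (Rep K (nquiver n Q) :: (_, nat \<times> 'a \<Rightarrow> 'v \<Rightarrow> 'v) cat) (glue_fctr n Q)"
    by (rule cat_equivalence_glue[OF wf])
  show "cat_equivalence (fd_nRep K n Q)
      (fd_Rep K (nquiver n Q) :: (_, nat \<times> 'a \<Rightarrow> 'v \<Rightarrow> 'v) cat) (glue_fctr n Q)"
    by (rule cat_equivalence_fd_glue[OF wf])
qed

end
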